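(* Let $p\ge1$ and $n\ge 2p$ be integers. The diameter of $\mathrm{St}(n,p)$ endowed with the Euclidean metric, i.e. $\sup_{U,\widetilde U\in\mathrm{St}(n,p)}d_{\mathrm E}(U,\widetilde U)$, is $\pi\sqrt p$. Moreover, for all $U,\widetilde U\in\mathrm{St}(n,p)$, we have $d_{\mathrm E}(U,\widetilde U)=\pi\sqrt p$ if and only if $\widetilde U=-U$.
   Context: The Stiefel manifold is $\mathrm{St}(n,p)=\{U\in\mathbb{R}^{n\times p} : U^TU=I_p\}$. The Euclidean metric is the one inherited from $\mathbb{R}^{n\times p}$ with the Frobenius inner product, and the Euclidean geodesic distance is $d_{\mathrm E}(U,\widetilde U)=\inf_\gamma\int_0^1\|\dot\gamma(t)\|_{\mathrm F}\,dt$, the infimum being over continuously differentiable curves $\gamma:[0,1]\to\mathrm{St}(n,p)$ with $\gamma(0)=U$, $\gamma(1)=\widetilde U$. *)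

theory Defs
  imports "HOL-Analysis.Analysis"
begin

text \<open>
  An \<open>n \<times> p\<close> real matrix is an element of \<open>real^'p^'n\<close>, with \<open>n = CARD('n)\<close> and
  \<open>p = CARD('p)\<close>; both are automatically at least 1.
\<close>

definition stiefel :: "(real^'p^'n) set" where
  "stiefel = {U. transpose U ** U = mat 1}"

text \<open>
  The norm that the library puts on \<open>real^'p^'n\<close> is the Frobenius norm (and not an operator norm).
\<close>

lemma norm_eq_frobenius:
  fixes A :: "real^'p^'n"
  shows "norm A = sqrt (\<Sum>i\<in>UNIV. \<Sum>j\<in>UNIV. (A $ i $ j)\<^sup>2)"
  by (simp add: norm_vec_def L2_set_def sum_nonneg)

text \<open>
  Derivatives are taken within \<open>{0..1}\<close>, hence are one-sided at the two endpoints.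
\<close>

definition stiefel_curve :: "real^'p^'n \<Rightarrow> real^'p^'n \<Rightarrow> (real \<Rightarrow> real^'p^'n) \<Rightarrow> bool" where
  "stiefel_curve U V \<gamma> \<longleftrightarrow>
     \<gamma> ` {0..1} \<subseteq> stiefel \<and> \<gamma> 0 = U \<and> \<gamma> 1 = V \<and>
     (\<exists>\<gamma>'. (\<forall>t\<in>{0..1}. (\<gamma> has_vector_derivative \<gamma>' t) (at t within {0..1})) \<and>
           continuous_on {0..1} \<gamma>')"

definition curve_length :: "(real \<Rightarrow> real^'p^'n) \<Rightarrow> real" where
  "curve_length \<gamma> = integral {0..1} (\<lambda>t. norm (vector_derivative \<gamma> (at t within {0..1})))"

text \<open>
  The distance is extended-real valued, so that it is infinite between points joined by no curve
  and neither the infimum here nor the supremum over pairs of points depends on the unspecified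
  values of \<open>Inf\<close> and \<open>Sup\<close> on the reals.
\<close>

definition euclidean_geodesic_dist :: "real^'p^'n \<Rightarrow> real^'p^'n \<Rightarrow> ereal" where
  "euclidean_geodesic_dist U V = (INF \<gamma>\<in>{\<gamma>. stiefel_curve U V \<gamma>}. ereal (curve_length \<gamma>))"

end

theory Submission
  imports Defs
begin

text \<open>
  Upper bound: as \<open>p < n\<close>, some rotation \<open>R \<in> SO(n)\<close> maps the columns of \<open>U\<close> to those of \<open>V\<close>.
  Write \<open>R = exp A\<close> with \<open>A\<close> skew and all rotation angles in \<open>[0, \<pi>]\<close>, so that \<open>\<parallel>A x\<parallel> \<le> \<pi> \<parallel>x\<parallel>\<close>,
  with equality only if \<open>R x = - x\<close>. The curve \<open>exp (t A) U\<close> has constant speed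
  \<open>\<parallel>A U\<parallel> \<le> \<pi> \<surd>p\<close>, with equality only if \<open>V = - U\<close>.

  Lower bound: the Stiefel manifold lies on the sphere of radius \<open>\<surd>p\<close>, on which
  antipodal points are at distance \<open>\<pi> \<surd>p\<close>.
\<close>

subsection \<open>Logarithms of orthogonal transformations\<close>

text \<open>
  On the invariant subspace \<open>S\<close>, \<open>E t\<close> plays the role of \<open>exp (t A)\<close> for a logarithm \<open>A\<close> of \<open>f\<close>
  with rotation angles in \<open>[0, \<pi>]\<close>; nothing is required outside \<open>S\<close>.
\<close>

definition short_flow :: "('a::euclidean_space \<Rightarrow> 'a) \<Rightarrow> 'a set \<Rightarrow> bool" where
  "short_flow f S \<longleftrightarrow> (\<exists>E A. linear A \<and> (\<forall>t::real. linear (E t)) \<and>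
     (\<forall>x\<in>S. A x \<in> S \<and> norm (A x) \<le> pi * norm x \<and> (norm (A x) = pi * norm x \<longrightarrow> f x = - x) \<and>
        E 0 x = x \<and> E 1 x = f x \<and>
        (\<forall>t. E t x \<in> S \<and> norm (E t x) = norm x \<and>
             ((\<lambda>t. E t x) has_vector_derivative E t (A x)) (at t))))"

definition perp_in :: "'a::euclidean_space set \<Rightarrow> 'a set \<Rightarrow> 'a set" where
  "perp_in S B = {y \<in> S. \<forall>x\<in>B. orthogonal x y}"

lemma perp_in_span: "perp_in S (span B) = perp_in S B"
  unfolding perp_in_def
  by (auto simp: orthogonal_commute intro: span_base orthogonal_to_span)

lemma perp_in_perp_in: "perp_in (perp_in S B) C = perp_in S (B \<union> C)"
  by (auto simp: perp_in_def)

lemma subspace_perp_in: "subspace S \<Longrightarrow> subspace (perp_in S B)"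
  by (auto simp: perp_in_def subspace_def orthogonal_clauses)

text \<open>An orthogonal transformation is injective, so the image has the full dimension of
  \<open>S\<close> and cannot be a proper subspace of it.\<close>

lemma orthogonal_transformation_image_eq:
  fixes f :: "'a::euclidean_space \<Rightarrow> 'a"
  assumes f: "orthogonal_transformation f" and S: "subspace S" "f ` S \<subseteq> S"
  shows "f ` S = S"
proof -
  have "dim (f ` S) = dim S"
    using f by (intro dim_image_eq) (auto simp: orthogonal_transformation_linear
        intro: inj_on_subset[OF orthogonal_transformation_inj])
  then show ?thesis
    using f S by (intro subspace_dim_equal)
      (auto intro: linear_subspace_image orthogonal_transformation_linear)
qed

text \<open>Since \<open>f\<close> maps \<open>B\<close> onto itself, each vector of
  \<open>B\<close> is some \<open>f b\<close> with \<open>b\<close> in \<open>B\<close>, and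
  \<open>f\<close> preserves orthogonality to \<open>b\<close>.\<close>

lemma invariant_perp_in:
  assumes f: "orthogonal_transformation f" and B: "subspace B" "f ` B \<subseteq> B" and S: "f ` S \<subseteq> S"
  shows "f ` perp_in S B \<subseteq> perp_in S B"
  using orthogonal_transformation_image_eq[OF f B] S f unfolding perp_in_def
  by (smt (verit, del_insts) image_iff image_subset_iff mem_Collect_eq orthogonal_orthogonal_transformation)

section \<open>Building flows: fixed spaces, planar rotations, orthogonal sums\<close>

text \<open>The constant flow with generator 0 works; equality in the norm bound then occurs only at
  \<open>x = 0\<close>.\<close>

lemma short_flow_fixed:
  assumes "\<And>x. x \<in> S \<Longrightarrow> f x = x" and "subspace S"
  shows "short_flow f S"
  unfolding short_flow_def
  by (rule exI[of _ "\<lambda>t x. x"], rule exI[of _ "\<lambda>x. 0"])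
    (use assms in \<open>auto simp: linear_iff subspace_0 pi_neq_zero\<close>)

text \<open>A rotation by \<theta> is reached through the rotations by \<open>t * \<theta>\<close>.
  The generator stretches the plane by the factor \<theta>, so equality at a nonzero vector means
  \<theta> = pi, where the rotation is minus the identity.\<close>

lemma short_flow_plane:
  assumes f: "linear f" and ab: "norm a = 1" "norm b = 1" "orthogonal a b"
    and \<theta>: "0 \<le> \<theta>" "\<theta> \<le> pi"
    and fa: "f a = cos \<theta> *\<^sub>R a + sin \<theta> *\<^sub>R b"
    and fb: "f b = - sin \<theta> *\<^sub>R a + cos \<theta> *\<^sub>R b"
  shows "short_flow f (span {a, b})"
proof -
  \<comment> \<open>Coordinates are read off by inner products, which makes both maps linear on the
    whole space. \<open>A\<close> is \<theta> times the quarter turn taking \<open>a\<close> to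
    \<open>b\<close>.\<close>
  define E where "E = (\<lambda>t x. (x \<bullet> a) *\<^sub>R (cos (t * \<theta>) *\<^sub>R a + sin (t * \<theta>) *\<^sub>R b)
      + (x \<bullet> b) *\<^sub>R (- sin (t * \<theta>) *\<^sub>R a + cos (t * \<theta>) *\<^sub>R b))"
  define A where "A = (\<lambda>x. \<theta> *\<^sub>R ((x \<bullet> a) *\<^sub>R b - (x \<bullet> b) *\<^sub>R a))"
  have ab': "a \<bullet> a = 1" "b \<bullet> b = 1" "a \<bullet> b = 0" "b \<bullet> a = 0" "a \<noteq> b"
    using ab by (auto simp: norm_eq_1 orthogonal_def inner_commute)
  have exp: "x = (x \<bullet> a) *\<^sub>R a + (x \<bullet> b) *\<^sub>R b" if "x \<in> span {a, b}" for x
  proof -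
    have "(\<Sum>i\<in>{a, b}. (x \<bullet> i) *\<^sub>R i) = x"
      using that ab by (intro orthonormal_basis_expand) (auto simp: pairwise_insert orthogonal_commute)
    then show ?thesis using ab' by simp
  qed
  have nrm: "norm (\<alpha> *\<^sub>R a + \<beta> *\<^sub>R b) = sqrt (\<alpha>\<^sup>2 + \<beta>\<^sup>2)" for \<alpha> \<beta>
    by (simp add: norm_eq_sqrt_inner inner_add_left inner_add_right ab' power2_eq_square)
  have lin: "\<alpha> *\<^sub>R a + \<beta> *\<^sub>R b \<in> span {a, b}" for \<alpha> \<beta>
    by (intro span_add span_scale span_base) auto
  have Anorm: "norm (A x) = \<theta> * norm x" if "x \<in> span {a, b}" for x
  proof -
    have "A x = (- \<theta> * (x \<bullet> b)) *\<^sub>R a + (\<theta> * (x \<bullet> a)) *\<^sub>R b"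
      by (simp add: A_def algebra_simps)
    then have "norm (A x) = sqrt ((- \<theta> * (x \<bullet> b))\<^sup>2 + (\<theta> * (x \<bullet> a))\<^sup>2)"
      by (simp only: nrm)
    also have "\<dots> = sqrt (\<theta>\<^sup>2 * ((x \<bullet> a)\<^sup>2 + (x \<bullet> b)\<^sup>2))"
      by (simp add: algebra_simps)
    also have "\<dots> = \<theta> * sqrt ((x \<bullet> a)\<^sup>2 + (x \<bullet> b)\<^sup>2)"
      using \<theta> by (simp add: real_sqrt_mult)
    also have "sqrt ((x \<bullet> a)\<^sup>2 + (x \<bullet> b)\<^sup>2) = norm x"
      using nrm[of "x \<bullet> a" "x \<bullet> b"] exp[OF that] by simp
    finally show ?thesis .
  qed
  have Eform: "E t x = ((x \<bullet> a) * cos (t * \<theta>) - (x \<bullet> b) * sin (t * \<theta>)) *\<^sub>R a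
       + ((x \<bullet> a) * sin (t * \<theta>) + (x \<bullet> b) * cos (t * \<theta>)) *\<^sub>R b" for t x
    by (simp add: E_def algebra_simps)
  have Enorm: "norm (E t x) = norm x" if "x \<in> span {a, b}" for t x
  proof -
    have "((x \<bullet> a) * cos (t * \<theta>) - (x \<bullet> b) * sin (t * \<theta>))\<^sup>2
       + ((x \<bullet> a) * sin (t * \<theta>) + (x \<bullet> b) * cos (t * \<theta>))\<^sup>2
       = ((x \<bullet> a)\<^sup>2 + (x \<bullet> b)\<^sup>2) * ((sin (t * \<theta>))\<^sup>2 + (cos (t * \<theta>))\<^sup>2)"
      by algebra
    then have "norm (E t x) = sqrt ((x \<bullet> a)\<^sup>2 + (x \<bullet> b)\<^sup>2)"
      by (simp only: Eform nrm sin_cos_squared_add mult_1_right)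
    also have "\<dots> = norm x"
      using nrm[of "x \<bullet> a" "x \<bullet> b"] exp[OF that] by simp
    finally show ?thesis .
  qed
  have Eder: "((\<lambda>t. E t x) has_vector_derivative E t (A x)) (at t)" for t x
    unfolding Eform has_vector_derivative_def
    by (rule derivative_eq_intros refl | simp)+
      (auto simp: A_def ab' inner_diff_left algebra_simps fun_eq_iff)
  have E1: "E 1 x = f x" if "x \<in> span {a, b}" for x
  proof -
    have "f x = (x \<bullet> a) *\<^sub>R f a + (x \<bullet> b) *\<^sub>R f b"
      by (subst exp[OF that]) (simp add: linear_add[OF f] linear_scale[OF f])
    then show ?thesis by (simp add: E_def fa fb)
  qed
  have E0: "E 0 x = x" if "x \<in> span {a, b}" for x
    using exp[OF that] by (simp add: E_def)
  have eq: "f x = - x" if x: "x \<in> span {a, b}" and "norm (A x) = pi * norm x" for x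
  proof (cases "x = 0")
    case True then show ?thesis using f by (simp add: linear_0)
  next
    case False
    then have "\<theta> = pi" using that Anorm[OF x] by simp
    then have "E 1 x = - ((x \<bullet> a) *\<^sub>R a + (x \<bullet> b) *\<^sub>R b)" by (simp add: E_def)
    then show ?thesis using E1[OF x] exp[OF x] by simp
  qed
  have "linear A" "\<And>t. linear (E t)"
    by (auto simp: A_def E_def linear_iff algebra_simps)
  moreover have "A x \<in> span {a, b}" for x
    unfolding A_def by (intro span_scale span_diff span_base) auto
  moreover have "E t x \<in> span {a, b}" for t x
    unfolding Eform by (rule lin)
  ultimately show ?thesis
    unfolding short_flow_def using Enorm Eder E0 E1 eq
    by (intro exI[of _ E] exI[of _ A]) (auto simp: Anorm \<theta> mult_right_mono)
qed

text \<open>The flows on \<open>B\<close> and on its complement act independently on the two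
  components of a vector. By Pythagoras, norms and the bound on the generator carry over to the
  sum.\<close>

lemma short_flow_sum:
  assumes f: "linear f" and S: "subspace S" "subspace B" "B \<subseteq> S"
    and flB: "short_flow f B" and flC: "short_flow f (perp_in S B)"
  shows "short_flow f S"
proof -
  define C where "C = perp_in S B"
  obtain D where D: "D \<subseteq> B" "pairwise orthogonal D" "\<And>x. x \<in> D \<Longrightarrow> norm x = 1" "independent D"
      "card D = dim B" "span D = B"
    using orthonormal_basis_subspace[OF S(2)] by metis
  then have "finite D" using independent_imp_finite by blast
  \<comment> \<open>The orthogonal projection onto \<open>B\<close>, written in an orthonormal basis
    of \<open>B\<close>.\<close>
  define P where "P = (\<lambda>x. \<Sum>d\<in>D. (x \<bullet> d) *\<^sub>R d)"
  have linP: "linear P"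
    by (auto simp: P_def linear_iff inner_add_left scaleR_add_left sum.distrib scaleR_right.sum
      intro!: sum.cong)
  have PB: "P x \<in> B" for x
    unfolding P_def using D S(2) by (auto intro!: subspace_sum subspace_scale)
  have Pb: "P x = x" if "x \<in> B" for x
    unfolding P_def using D that \<open>finite D\<close> by (intro orthonormal_basis_expand) auto
  have Pc: "P x = 0" if "x \<in> C" for x
    unfolding P_def using that D(1)
    by (auto simp: C_def perp_in_def orthogonal_def inner_commute intro!: sum.neutral)
  have dec: "x - P x \<in> C" if "x \<in> S" for x
  proof -
    obtain y z where yz: "y \<in> span B" "\<And>w. w \<in> span B \<Longrightarrow> orthogonal z w" "x = y + z"
      using orthogonal_subspace_decomp_exists by metis
    then have y: "y \<in> B" using S span_eq_iff by blast
    then have "z \<in> S" using yz that S by (metis add_diff_cancel_left' subsetD subspace_diff)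
    then have "z \<in> C" using yz(2) by (auto simp: C_def perp_in_def orthogonal_commute span_base)
    moreover have "P x = y" using Pb[OF y] Pc[OF \<open>z \<in> C\<close>] linear_add[OF linP] yz(3) by simp
    ultimately show ?thesis using yz(3) by simp
  qed
  have C: "subspace C" unfolding C_def by (rule subspace_perp_in[OF S(1)])
  have CS: "C \<subseteq> S" by (auto simp: C_def perp_in_def)
  have orth: "orthogonal b c" if "b \<in> B" "c \<in> C" for b c
    using that by (auto simp: C_def perp_in_def)
  obtain E1 A1 where 1: "linear A1" "\<And>t. linear (E1 t)"
    "\<And>x. x \<in> B \<Longrightarrow> A1 x \<in> B \<and> norm (A1 x) \<le> pi * norm x \<and> (norm (A1 x) = pi * norm x \<longrightarrow> f x = - x) \<and>
        E1 0 x = x \<and> E1 1 x = f x"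
    "\<And>x t. x \<in> B \<Longrightarrow> E1 t x \<in> B \<and> norm (E1 t x) = norm x \<and>
             ((\<lambda>t. E1 t x) has_vector_derivative E1 t (A1 x)) (at t)"
    using flB unfolding short_flow_def by blast
  obtain E2 A2 where 2: "linear A2" "\<And>t. linear (E2 t)"
    "\<And>x. x \<in> C \<Longrightarrow> A2 x \<in> C \<and> norm (A2 x) \<le> pi * norm x \<and> (norm (A2 x) = pi * norm x \<longrightarrow> f x = - x) \<and>
        E2 0 x = x \<and> E2 1 x = f x"
    "\<And>x t. x \<in> C \<Longrightarrow> E2 t x \<in> C \<and> norm (E2 t x) = norm x \<and>
             ((\<lambda>t. E2 t x) has_vector_derivative E2 t (A2 x)) (at t)"
    using flC unfolding short_flow_def C_def[symmetric] by blast
  define E where "E = (\<lambda>t x. E1 t (P x) + E2 t (x - P x))"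
  define A where "A = (\<lambda>x. A1 (P x) + A2 (x - P x))"
  have linQ: "linear (\<lambda>x. x - P x)"
    using linear_compose_sub[OF linear_ident linP] .
  have linE: "linear (E t)" for t
    using linear_compose_add[OF linear_compose[OF linP 1(2)] linear_compose[OF linQ 2(2)]]
    by (simp add: o_def E_def)
  have linA: "linear A"
    using linear_compose_add[OF linear_compose[OF linP 1(1)] linear_compose[OF linQ 2(1)]]
    by (simp add: o_def A_def)
  have main: "A x \<in> S \<and> norm (A x) \<le> pi * norm x \<and> (norm (A x) = pi * norm x \<longrightarrow> f x = - x) \<and>
        E 0 x = x \<and> E 1 x = f x \<and>
        (\<forall>t. E t x \<in> S \<and> norm (E t x) = norm x \<and>
             ((\<lambda>t. E t x) has_vector_derivative E t (A x)) (at t))" if "x \<in> S" for x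
  proof -
    define b c where "b = P x" and "c = x - P x"
    have b: "b \<in> B" and c: "c \<in> C" and x: "x = b + c"
      using PB dec[OF that] by (auto simp: b_def c_def)
    note b1 = 1(3)[OF b] and b2 = 1(4)[OF b] and c1 = 2(3)[OF c] and c2 = 2(4)[OF c]
    have Ax: "A x = A1 b + A2 c" and Ex: "E t x = E1 t b + E2 t c" for t
      by (simp_all add: A_def E_def b_def c_def)
    \<comment> \<open>Both generators preserve their subspaces, so \<open>A1 b\<close> and
      \<open>A2 c\<close> are the components of \<open>A x\<close>; hence \<open>E t (A x)\<close>
      also splits.\<close>
    have PA: "P (A x) = A1 b"
      using Pb[of "A1 b"] Pc[of "A2 c"] b1 c1 by (simp add: Ax linear_add[OF linP])
    have EA: "E t (A x) = E1 t (A1 b) + E2 t (A2 c)" for t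
      by (simp add: E_def PA) (simp add: Ax)
    have nx: "(norm x)\<^sup>2 = (norm b)\<^sup>2 + (norm c)\<^sup>2"
      unfolding x using orth b c by (intro norm_add_Pythagorean) auto
    have nA: "(norm (A x))\<^sup>2 = (norm (A1 b))\<^sup>2 + (norm (A2 c))\<^sup>2"
      unfolding Ax using orth b1 c1 by (intro norm_add_Pythagorean) auto
    have nE: "(norm (E t x))\<^sup>2 = (norm x)\<^sup>2" for t
      unfolding Ex nx using orth b2 c2 by (subst norm_add_Pythagorean) auto
    have lb: "(norm (A1 b))\<^sup>2 \<le> (pi * norm b)\<^sup>2" and lc: "(norm (A2 c))\<^sup>2 \<le> (pi * norm c)\<^sup>2"
      using b1 c1 by (auto intro: power_mono)
    then have "(norm (A x))\<^sup>2 \<le> (pi * norm x)\<^sup>2"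
      unfolding nA power_mult_distrib nx by (simp add: distrib_left)
    then have le: "norm (A x) \<le> pi * norm x"
      by (rule power2_le_imp_le) simp
    \<comment> \<open>Two inequalities whose sum is an equality are both equalities, so
      \<open>f\<close> negates \<open>b\<close> and \<open>c\<close> separately.\<close>
    have eq: "f x = - x" if h: "norm (A x) = pi * norm x"
    proof -
      have "(norm (A1 b))\<^sup>2 + (norm (A2 c))\<^sup>2 = (pi * norm b)\<^sup>2 + (pi * norm c)\<^sup>2"
        using h nA nx by (simp add: power_mult_distrib distrib_left)
      then have "(norm (A1 b))\<^sup>2 = (pi * norm b)\<^sup>2" "(norm (A2 c))\<^sup>2 = (pi * norm c)\<^sup>2"
        using lb lc by linarith+
      then have "norm (A1 b) = pi * norm b" "norm (A2 c) = pi * norm c"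
        by (auto intro: power2_eq_imp_eq)
      then show ?thesis using b1 c1 unfolding x by (simp add: linear_add[OF f])
    qed
    have der: "((\<lambda>t. E t x) has_vector_derivative E t (A x)) (at t)" for t
      unfolding EA Ex using b2 c2 by (auto intro: has_vector_derivative_add)
    have "A x \<in> S" "\<And>t. E t x \<in> S"
      using b1 c1 b2 c2 S CS unfolding Ax Ex by (auto intro!: subspace_add)
    moreover have "E 0 x = x" using b1 c1 Ex x by simp
    moreover have "E 1 x = f x" using b1 c1 Ex x by (simp add: linear_add[OF f])
    moreover have "norm (E t x) = norm x" for t
      using nE by (auto intro: power2_eq_imp_eq)
    ultimately show ?thesis using le eq der by simp
  qed
  then show ?thesis
    unfolding short_flow_def using linE linA by blast
qed

section \<open>Invariant lines and planes of an orthogonal transformation\<close>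

text \<open>The maximum over the compact unit sphere of \<open>S\<close> exists, and scaling extends
  the bound to all of \<open>S\<close>.\<close>

lemma exists_max_quadratic:
  fixes f :: "'a::euclidean_space \<Rightarrow> 'a"
  assumes f: "linear f" and S: "subspace S" "S \<noteq> {0}"
  obtains x where "x \<in> S" "norm x = 1" "\<And>y. y \<in> S \<Longrightarrow> y \<bullet> f y \<le> (x \<bullet> f x) * (y \<bullet> y)"
proof -
  have K: "compact (sphere 0 1 \<inter> S)"
    using closed_subspace[OF S(1)] by (intro compact_Int_closed) auto
  obtain z where z: "z \<in> S" "z \<noteq> 0" using S subspace_0 by blast
  then have "z /\<^sub>R norm z \<in> sphere 0 1 \<inter> S"
    using S by (auto simp: subspace_scale)
  then have ne: "sphere 0 1 \<inter> S \<noteq> {}" by blast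
  have "continuous_on (sphere 0 1 \<inter> S) (\<lambda>y. y \<bullet> f y)"
    using f by (intro continuous_intros linear_continuous_on) (simp add: linear_conv_bounded_linear)
  then obtain x where x: "x \<in> sphere 0 1 \<inter> S" "\<And>y. y \<in> sphere 0 1 \<inter> S \<Longrightarrow> y \<bullet> f y \<le> x \<bullet> f x"
    using continuous_attains_sup[OF K ne] by blast
  have "y \<bullet> f y \<le> (x \<bullet> f x) * (y \<bullet> y)" if "y \<in> S" for y
  proof (cases "y = 0")
    case False
    define w where "w = y /\<^sub>R norm y"
    have y: "y = norm y *\<^sub>R w" using False by (simp add: w_def)
    have "w \<in> sphere 0 1 \<inter> S" using that False S by (auto simp: w_def subspace_scale)
    then have "w \<bullet> f w \<le> x \<bullet> f x" by (rule x(2))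
    then have "(norm y)\<^sup>2 * (w \<bullet> f w) \<le> (norm y)\<^sup>2 * (x \<bullet> f x)"
      by (intro mult_left_mono) auto
    moreover have "y \<bullet> f y = (norm y)\<^sup>2 * (w \<bullet> f w)"
      by (subst (1 2) y) (simp add: linear_scale[OF f] power2_eq_square)
    ultimately show ?thesis by (simp add: power2_norm_eq_inner mult.commute)
  qed simp
  with x that show ?thesis by auto
qed

text \<open>
  A maximiser of \<open>x \<bullet> f x\<close> on the unit sphere is an eigenvector of \<open>f + f\<^sup>T\<close>, where \<open>f\<^sup>T = f\<^sup>-\<^sup>1\<close>.
\<close>

lemma orthogonal_quadratic_relation:
  fixes f :: "'a::euclidean_space \<Rightarrow> 'a"
  assumes f: "orthogonal_transformation f" and S: "subspace S" "f ` S \<subseteq> S" "S \<noteq> {0}"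
  obtains x c where "x \<in> S" "norm x = 1" "c = x \<bullet> f x" "f (f x) = (2 * c) *\<^sub>R f x - x"
proof -
  have lin: "linear f" using f by (rule orthogonal_transformation_linear)
  have iso: "f v \<bullet> f w = v \<bullet> w" for v w using f by (simp add: orthogonal_transformation_def)
  obtain x where x: "x \<in> S" "norm x = 1" and max: "\<And>y. y \<in> S \<Longrightarrow> y \<bullet> f y \<le> (x \<bullet> f x) * (y \<bullet> y)"
    using exists_max_quadratic[OF lin S(1,3)] by blast
  define c where "c = x \<bullet> f x"
  \<comment> \<open>First-order condition at the maximiser. Perturbing \<open>x\<close> to
    \<open>x + t *\<^sub>R y\<close> leaves \<open>t * l + t\<^sup>2 * q\<close> nonnegative for
    every \<open>t\<close>, which forces the linear coefficient \<open>l\<close> to vanish.\<close>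
  have var: "x \<bullet> f y + y \<bullet> f x = 2 * c * (x \<bullet> y)" if y: "y \<in> S" for y
  proof -
    define l where "l = 2 * c * (x \<bullet> y) - (x \<bullet> f y + y \<bullet> f x)"
    define q where "q = c * (y \<bullet> y) - y \<bullet> f y"
    have pos: "0 \<le> t * l + t\<^sup>2 * q" for t
    proof -
      have "x + t *\<^sub>R y \<in> S" using x y S by (intro subspace_add subspace_scale)
      from max[OF this] show ?thesis using x(2)
        by (simp add: l_def q_def c_def linear_add[OF lin] linear_scale[OF lin] inner_add_left inner_add_right
             power2_eq_square norm_eq_1 algebra_simps inner_commute)
    qed
    have "l = 0"
    proof (rule ccontr)
      assume l: "l \<noteq> 0"
      have "q \<ge> 0" using max[OF y] by (simp add: q_def c_def)
      \<comment> \<open>Chosen so that \<open>l = - t * (q + 1)\<close>, which turns the expression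
        into \<open>- t\<^sup>2\<close>; the \<open>+ 1\<close> keeps the denominator
        positive.\<close>
      define t where "t = - l / (q + 1)"
      have "l = - t * (q + 1)" using \<open>q \<ge> 0\<close> by (simp add: t_def)
      then have "t * l + t\<^sup>2 * q = - (t\<^sup>2)"
        by algebra
      also have "\<dots> < 0" using l \<open>q \<ge> 0\<close> by (simp add: t_def)
      finally show False using pos[of t] by simp
    qed
    then show ?thesis by (simp add: l_def)
  qed
  \<comment> \<open>The image under \<open>f\<close> of the eigenvector defect of \<open>x\<close>
    for \<open>f + f\<^sup>T\<close>. By \<open>var\<close> it is orthogonal to every
    \<open>f y\<close> with \<open>y\<close> in \<open>S\<close>; as \<open>f\<close> maps
    \<open>S\<close> onto itself, \<open>w\<close> is such an \<open>f y\<close>, hence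
    zero.\<close>
  define w where "w = f (f x) + x - (2 * c) *\<^sub>R f x"
  have "w \<in> S" using x S unfolding w_def
    by (intro subspace_add subspace_diff subspace_scale) (auto simp: image_subset_iff)
  moreover have "f ` S = S" using orthogonal_transformation_image_eq[OF f S(1,2)] .
  ultimately obtain y where y: "y \<in> S" "w = f y" by (metis imageE)
  have "w \<bullet> f y = f x \<bullet> y + x \<bullet> f y - 2 * c * (x \<bullet> y)"
    by (simp add: w_def inner_add_left inner_diff_left iso)
  then have "w \<bullet> f y = 0" using var[OF y(1)] by (simp add: inner_commute)
  then have "w = 0" using y by simp
  then have "f (f x) = (2 * c) *\<^sub>R f x - x" by (simp add: w_def algebra_simps)
  with x c_def that show ?thesis by blast
qed

text \<open>The quadratic relation makes the span of \<open>x\<close> and \<open>f x\<close>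
  invariant. It is a rotated plane, or a line on which \<open>f\<close> is 1 or -1. A line with
  eigenvalue -1 carries no flow of its own and is therefore reported separately.\<close>

lemma orthogonal_block:
  assumes f: "orthogonal_transformation f" and S: "subspace S" "f ` S \<subseteq> S" "S \<noteq> {0}"
  obtains (block) B where "subspace B" "B \<subseteq> S" "B \<noteq> {0}" "f ` B \<subseteq> B" "short_flow f B"
    | (neg) x where "x \<in> S" "norm x = 1" "f x = - x"
proof -
  have lin: "linear f" using f by (rule orthogonal_transformation_linear)
  have iso: "f v \<bullet> f w = v \<bullet> w" for v w using f by (simp add: orthogonal_transformation_def)
  obtain x c where x: "x \<in> S" "norm x = 1" "c = x \<bullet> f x" "f (f x) = (2 * c) *\<^sub>R f x - x"
    using orthogonal_quadratic_relation[OF f S] by blast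
  have xx: "x \<bullet> x = 1" using x by (simp add: norm_eq_1)
  have x0: "x \<noteq> 0" using xx by auto
  have fxfx: "f x \<bullet> f x = 1" by (simp add: iso xx)
  \<comment> \<open>The part of \<open>f x\<close> orthogonal to \<open>x\<close>; it vanishes
    exactly when \<open>x\<close> is an eigenvector.\<close>
  define v where "v = f x - c *\<^sub>R x"
  have vv: "v \<bullet> v = 1 - c\<^sup>2"
    using x(3) by (simp add: v_def inner_diff_left inner_diff_right xx fxfx inner_commute power2_eq_square algebra_simps)
  show thesis
  proof (cases "v = 0")
    case True
    then have fx: "f x = c *\<^sub>R x" and "c\<^sup>2 = 1" using vv by (simp_all add: v_def)
    then consider "c = 1" | "c = -1" by (auto simp: power2_eq_1_iff)
    then show thesis
    proof cases
      case 1
      then have fix_x: "f y = y" if "y \<in> span {x}" for y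
        using that fx by (auto simp: span_singleton linear_scale[OF lin])
      show thesis
      proof (rule block[of "span {x}"])
        show "subspace (span {x})" by (rule subspace_span)
        show "span {x} \<subseteq> S" using x S by (simp add: span_minimal)
        show "span {x} \<noteq> {0}" using x0 by (metis insertI1 singletonD span_base)
        show "f ` span {x} \<subseteq> span {x}" using fix_x by auto
        show "short_flow f (span {x})" by (intro short_flow_fixed fix_x subspace_span)
      qed
    next
      case 2
      then have "f x = - x" using fx by simp
      with x(1,2) show thesis by (rule neg)
    qed
  next
    case False
    then have c: "c\<^sup>2 < 1" using vv by (metis diff_gt_0_iff_gt inner_gt_zero_iff)
    then have c1: "\<bar>c\<bar> < 1" by (simp add: abs_square_less_1)
    define \<theta> where "\<theta> = arccos c"
    have \<theta>: "0 \<le> \<theta>" "\<theta> \<le> pi" "cos \<theta> = c"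
      using c1 by (auto simp: \<theta>_def arccos_lbound arccos_ubound)
    have s: "sin \<theta> = sqrt (1 - c\<^sup>2)" "sin \<theta> > 0"
      using c1 c by (auto simp: \<theta>_def sin_arccos_abs)
    have s2: "sin \<theta> * sin \<theta> = 1 - c * c" using c by (simp add: s power2_eq_square)
    \<comment> \<open>With \<open>c = cos \<theta>\<close>, \<open>v\<close> has length
      \<open>sin \<theta>\<close>, so \<open>b\<close> completes \<open>x\<close> to an orthonormal
      basis of the plane.\<close>
    define b where "b = (1 / sin \<theta>) *\<^sub>R v"
    have vb: "v = sin \<theta> *\<^sub>R b" using s by (simp add: b_def)
    have fx: "f x = cos \<theta> *\<^sub>R x + sin \<theta> *\<^sub>R b"
      unfolding vb[symmetric] \<theta> by (simp add: v_def)
    have "b \<bullet> b = 1" using vv s c by (simp add: b_def power2_eq_square[symmetric] power_divide)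
    then have nb: "norm b = 1" by (simp add: norm_eq_1)
    have ob: "orthogonal x b" by (simp add: b_def v_def orthogonal_def inner_diff_right xx x(3)[symmetric])
    \<comment> \<open>The relation for \<open>f (f x)\<close> determines \<open>f v\<close>;
      dividing by \<open>sin \<theta>\<close> gives the second column of the rotation
      matrix.\<close>
    have "(2 * c) *\<^sub>R f x = c *\<^sub>R f x + c *\<^sub>R f x"
      by (simp only: mult_2 scaleR_add_left)
    then have "f v = c *\<^sub>R f x - x"
      unfolding v_def linear_diff[OF lin] linear_scale[OF lin] x(4) by simp
    also have "\<dots> = (sin \<theta> * c) *\<^sub>R b - (sin \<theta> * sin \<theta>) *\<^sub>R x"
      by (simp add: fx \<theta> s2 algebra_simps)
    also have "\<dots> = sin \<theta> *\<^sub>R (- sin \<theta> *\<^sub>R x + cos \<theta> *\<^sub>R b)"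
      by (simp add: \<theta> algebra_simps)
    finally have fb: "f b = - sin \<theta> *\<^sub>R x + cos \<theta> *\<^sub>R b"
      using s by (simp add: b_def linear_scale[OF lin])
    have bS: "b \<in> S" using x S unfolding b_def v_def
      by (intro subspace_diff subspace_scale) auto
    show thesis
    proof (rule block[of "span {x, b}"])
      show "subspace (span {x, b})" by (rule subspace_span)
      show "span {x, b} \<subseteq> S" using x S bS by (simp add: span_minimal)
      show "span {x, b} \<noteq> {0}" using x0 by (metis insertI1 singletonD span_base)
      show "short_flow f (span {x, b})"
        using short_flow_plane[OF lin x(2) nb ob \<theta>(1,2) fx fb] .
      have "f ` {x, b} \<subseteq> span {x, b}"
        unfolding image_insert fx fb image_empty insert_subset
        by (intro conjI span_add span_scale span_base) auto
      then show "f ` span {x, b} \<subseteq> span {x, b}"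
        unfolding linear_span_image[OF lin, symmetric] by (simp add: span_minimal)
    qed
  qed
qed

text \<open>
  Eigenvectors for \<open>- 1\<close> are joined in pairs into planes rotated by \<open>\<pi>\<close>, which leaves at most
  one of them over.
\<close>

lemma orthogonal_short_flow_or_neg:
  assumes f: "orthogonal_transformation f" and "subspace S" "f ` S \<subseteq> S"
  shows "short_flow f S \<or> (\<exists>e\<in>S. norm e = 1 \<and> f e = - e \<and> short_flow f (perp_in S {e}))"
  using assms(2,3)
proof (induction "dim S" arbitrary: S rule: less_induct)
  case less
  note S = less.prems
  have lin: "linear f" using f by (rule orthogonal_transformation_linear)
  \<comment> \<open>Splitting off a nonzero invariant subspace leaves an invariant complement of
    smaller dimension.\<close>
  have IH: "short_flow f (perp_in S B) \<or>
      (\<exists>e\<in>perp_in S B. norm e = 1 \<and> f e = - e \<and> short_flow f (perp_in (perp_in S B) {e}))"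
    if B: "subspace B" "B \<subseteq> S" "B \<noteq> {0}" "f ` B \<subseteq> B" for B
  proof (rule less.hyps)
    have "dim (perp_in S B) + dim B = dim S"
      unfolding perp_in_def using B S by (intro dim_subspace_orthogonal_to_vectors)
    moreover have "dim B > 0"
      using B subspace_0[OF B(1)] dim_eq_0[of B] by (metis bot_nat_0.not_eq_extremum empty_iff subset_singletonD)
    ultimately show "dim (perp_in S B) < dim S" by simp
    show "subspace (perp_in S B)" by (rule subspace_perp_in[OF S(1)])
    show "f ` perp_in S B \<subseteq> perp_in S B" by (rule invariant_perp_in[OF f B(1,4) S(2)])
  qed
  show ?case
  proof (cases "S = {0}")
    case True
    then have "short_flow f S" using lin by (intro short_flow_fixed) (auto simp: linear_0)
    then show ?thesis ..
  next
    case False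
    from f S False show ?thesis
    proof (cases rule: orthogonal_block)
      case (block B)
      from IH[OF block(1-4)] show ?thesis
      proof (elim disjE bexE conjE)
        assume "short_flow f (perp_in S B)"
        then show ?thesis using short_flow_sum[OF lin S(1) block(1,2,5)] by blast
      next
        fix e assume e: "e \<in> perp_in S B" "norm e = 1" "f e = - e"
          and fl: "short_flow f (perp_in (perp_in S B) {e})"
        \<comment> \<open>The leftover \<open>e\<close> is orthogonal to \<open>B\<close>, so
          \<open>B\<close> can be added back inside the complement of \<open>e\<close>.\<close>
        have "short_flow f (perp_in S {e})"
        proof (rule short_flow_sum[OF lin])
          show "subspace (perp_in S {e})" by (rule subspace_perp_in[OF S(1)])
          show "B \<subseteq> perp_in S {e}" using e(1) block(2) by (auto simp: perp_in_def orthogonal_commute)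
          show "short_flow f (perp_in (perp_in S {e}) B)"
            using fl by (simp add: perp_in_perp_in Un_commute)
        qed (fact block(1,5))+
        moreover have "e \<in> S" using e(1) by (simp add: perp_in_def)
        ultimately show ?thesis using e(2,3) by blast
      qed
    next
      case (neg x)
      have neg_span: "f ` span {x} \<subseteq> span {x}"
        unfolding linear_span_image[OF lin, symmetric]
        using neg(3) by (simp add: span_minimal span_neg span_base)
      have "span {x} \<subseteq> S" using neg(1) S by (simp add: span_minimal)
      moreover have "span {x} \<noteq> {0}"
        using neg(2) by (metis insertI1 norm_zero singletonD span_base zero_neq_one)
      ultimately have "short_flow f (perp_in S {x}) \<or>
         (\<exists>e\<in>perp_in S {x}. norm e = 1 \<and> f e = - e \<and> short_flow f (perp_in (perp_in S {x}) {e}))"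
        using IH[of "span {x}"] neg_span by (simp add: perp_in_span)
      then show ?thesis
      proof (elim disjE bexE conjE)
        assume "short_flow f (perp_in S {x})"
        then show ?thesis using neg by blast
      next
        fix e assume e: "e \<in> perp_in S {x}" "norm e = 1" "f e = - e"
          and fl: "short_flow f (perp_in (perp_in S {x}) {e})"
        \<comment> \<open>\<open>x\<close> and \<open>e\<close> are orthonormal and both negated:
          their plane is rotated by pi.\<close>
        have "short_flow f (span {x, e})"
          using e neg lin by (intro short_flow_plane[where \<theta> = pi]) (auto simp: perp_in_def)
        moreover have "perp_in S (span {x, e}) = perp_in (perp_in S {x}) {e}"
          by (simp add: perp_in_perp_in perp_in_span insert_commute)
        moreover have "span {x, e} \<subseteq> S"
          using e(1) neg(1) S by (simp add: span_minimal perp_in_def)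
        ultimately have "short_flow f S"
          using short_flow_sum[OF lin S(1), of "span {x, e}"] fl by simp
        then show ?thesis ..
      qed
    qed
  qed
qed

subsection \<open>Rotations\<close>

text \<open>The Householder reflection in the hyperplane orthogonal to \<open>z\<close>; for
  \<open>z = 0\<close> it is the identity.\<close>

definition reflect :: "'a::real_inner \<Rightarrow> 'a \<Rightarrow> 'a" where
  "reflect z x = x - (2 * (x \<bullet> z) / (z \<bullet> z)) *\<^sub>R z"

lemma orthogonal_transformation_reflect: "orthogonal_transformation (reflect z)"
proof (cases "z = 0")
  case False
  then show ?thesis
    by (auto simp: orthogonal_transformation_def reflect_def linear_iff inner_add_left inner_diff_left
        inner_diff_right add_divide_distrib algebra_simps inner_commute)
qed (simp add: reflect_def[abs_def])

lemma reflect_perp: "x \<bullet> z = 0 \<Longrightarrow> reflect z x = x"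
  by (simp add: reflect_def)

lemma reflect_self: "reflect z z = - z"
  by (simp add: reflect_def scaleR_2)

text \<open>Equal norms give \<open>(v - w) \<bullet> (v - w) = 2 * (v \<bullet> (v - w))\<close>,
  so the reflection subtracts exactly \<open>v - w\<close>. The case \<open>v = w\<close> is the
  identity.\<close>

lemma reflect_swap:
  assumes "norm v = norm w"
  shows "reflect (v - w) v = w"
proof (cases "v = w")
  case False
  have "v \<bullet> v = w \<bullet> w" using assms by (simp add: norm_eq)
  then have "(v - w) \<bullet> (v - w) = 2 * (v \<bullet> (v - w))"
    by (simp add: inner_diff_left inner_diff_right inner_commute)
  moreover have "(v - w) \<bullet> (v - w) \<noteq> 0" using False by simp
  ultimately have "2 * (v \<bullet> (v - w)) / ((v - w) \<bullet> (v - w)) = 1" by simp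
  then show ?thesis by (simp only: reflect_def) simp
qed (simp add: reflect_def)

text \<open>An orthogonal \<open>g\<close> taking a coordinate axis to the direction of
  \<open>z\<close> conjugates the reflection to a diagonal matrix with a single entry -1.\<close>

lemma det_reflect:
  fixes z :: "real^'n"
  assumes "z \<noteq> 0"
  shows "det (matrix (reflect z)) = - 1"
proof -
  obtain k :: 'n where True by simp
  have ax: "axis k c = c *\<^sub>R axis k (1::real)" for c
    by (simp add: axis_def vec_eq_iff)
  obtain g where g: "orthogonal_transformation g" "g (axis k (norm z)) = z"
    using orthogonal_transformation_exists[of "axis k (norm z)" z] by (auto simp: ax[of "norm z"])
  define D where "D = matrix (reflect (axis k 1 :: real^'n))"
  have ling: "linear g" "linear (reflect z)" "linear (reflect (axis k (1::real)))"
    using g orthogonal_transformation_reflect by (auto intro: orthogonal_transformation_linear)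
  have gz: "z = norm z *\<^sub>R g (axis k 1)"
    using g(2) linear_scale[OF ling(1), of "norm z" "axis k 1"] by (simp add: ax[of "norm z"])
  have "reflect z (g x) = g (reflect (axis k 1) x)" for x
  proof -
    have "g x \<bullet> z = norm z * (x \<bullet> axis k 1)"
      using g(1) by (subst gz) (simp add: orthogonal_transformation_def)
    then have "2 * (g x \<bullet> z) / (z \<bullet> z) * norm z = 2 * (x \<bullet> axis k 1)"
      using assms by (simp add: power2_norm_eq_inner[symmetric] power2_eq_square)
    moreover have "reflect z (g x) = g x - (2 * (g x \<bullet> z) / (z \<bullet> z) * norm z) *\<^sub>R g (axis k 1)"
      using gz unfolding reflect_def by (metis scaleR_scaleR)
    ultimately show ?thesis
      by (simp add: reflect_def linear_diff[OF ling(1)] linear_scale[OF ling(1)] inner_axis_axis)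
  qed
  then have "matrix (reflect z) ** matrix g = matrix g ** D"
    unfolding D_def using ling by (simp add: matrix_compose[symmetric] o_def)
  then have "det (matrix (reflect z)) * det (matrix g) = det (matrix g) * det D"
    by (metis det_mul)
  moreover have "det (matrix g) \<noteq> 0"
    using orthogonal_transformation_det[OF g(1)] by auto
  moreover have "det D = - 1"
  proof -
    have D: "D $ i $ j = (if i = j then (if i = k then -1 else 1) else 0)" for i j
    proof -
      have "D $ i $ j = (axis j 1 - (2 * (if j = k then 1 else 0)) *\<^sub>R axis k 1 :: real^'n) $ i"
        by (simp add: D_def matrix_def reflect_def inner_axis_axis)
      then show ?thesis by (auto simp: axis_def)
    qed
    then have "det D = (\<Prod>i\<in>UNIV. D $ i $ i)" by (intro det_diagonal) simp
    also have "\<dots> = - 1" by (simp add: D)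
    finally show ?thesis .
  qed
  ultimately show ?thesis by (metis mult.commute mult_cancel_left)
qed

text \<open>The determinant of \<open>E t\<close> is continuous in \<open>t\<close>, has absolute
  value 1 and equals 1 at \<open>t = 0\<close>. A change of sign would force a zero in
  between.\<close>

lemma det_eq_1_if_short_flow:
  fixes f :: "real^'n \<Rightarrow> real^'n"
  assumes "short_flow f UNIV"
  shows "det (matrix f) = 1"
proof -
  obtain E A where E: "\<And>t. linear (E t)" "\<And>x. E 0 x = x" "\<And>x. E 1 x = f x"
     "\<And>t x. norm (E t x) = norm x" "\<And>t x. ((\<lambda>t. E t x) has_vector_derivative E t (A x)) (at t)"
    using assms unfolding short_flow_def by simp metis
  define d where "d = (\<lambda>t. det (matrix (E t)))"
  have "continuous_on UNIV (\<lambda>t. E t x)" for x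
    using E(5) by (meson continuous_at_imp_continuous_on has_vector_derivative_continuous)
  then have cont: "continuous_on UNIV d"
    unfolding d_def det_def matrix_def by (simp, intro continuous_intros) auto
  have "orthogonal_transformation (E t)" for t
    using E by (simp add: orthogonal_transformation)
  then have abs1: "\<bar>d t\<bar> = 1" for t
    unfolding d_def by (rule orthogonal_transformation_det)
  have "E 0 = (\<lambda>x. x)" "E 1 = f" using E by auto
  then have d0: "d 0 = 1" and d1: "d 1 = det (matrix f)"
    by (simp_all add: d_def matrix_id_mat_1[unfolded id_def])
  have "d 1 \<noteq> - 1"
  proof
    assume "d 1 = - 1"
    then have "\<exists>t\<ge>0. t \<le> 1 \<and> d t = 0"
      using d0 cont by (intro IVT2') (auto intro: continuous_on_subset)
    then show False using abs1 by (metis abs_0 zero_neq_one)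
  qed
  then show ?thesis using abs1[of 1] d1 by (auto simp: abs_if split: if_splits)
qed

lemma short_flow_cong:
  "(\<And>x. x \<in> S \<Longrightarrow> f x = g x) \<Longrightarrow> short_flow f S \<Longrightarrow> short_flow g S"
  by (simp add: short_flow_def cong: ball_cong)

text \<open>
  If an eigenvector \<open>e\<close> for \<open>- 1\<close> is left over, then \<open>f \<circ> reflect e\<close> has a flow, hence determinant 1.
\<close>

lemma rotation_short_flow:
  fixes f :: "real^'n \<Rightarrow> real^'n"
  assumes f: "orthogonal_transformation f" and det: "det (matrix f) = 1"
  shows "short_flow f UNIV"
proof (rule ccontr)
  assume "\<not> short_flow f UNIV"
  then obtain e where e: "norm e = 1" "f e = - e" and fl: "short_flow f (perp_in UNIV {e})"
    using orthogonal_short_flow_or_neg[OF f, of UNIV] by auto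
  define g where "g = f \<circ> reflect e"
  have lin: "linear f" "linear (reflect e)"
    using f orthogonal_transformation_reflect by (auto intro: orthogonal_transformation_linear)
  have ling: "linear g" unfolding g_def by (rule linear_compose[OF lin(2,1)])
  have "short_flow g (perp_in UNIV {e})"
    using fl by (rule short_flow_cong[rotated])
      (auto simp: g_def perp_in_def orthogonal_def inner_commute reflect_perp)
  then have "short_flow g (perp_in UNIV (span {e}))" by (simp add: perp_in_span)
  moreover have "short_flow g (span {e})"
  proof (rule short_flow_fixed)
    have "g e = e" using e by (simp add: g_def reflect_self linear_neg[OF lin(1)])
    then show "\<And>x. x \<in> span {e} \<Longrightarrow> g x = x"
      by (auto simp: span_singleton linear_scale[OF ling])
  qed (rule subspace_span)
  ultimately have "short_flow g UNIV"
    by (intro short_flow_sum[OF ling, of UNIV "span {e}"]) auto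
  then have "det (matrix g) = 1" by (rule det_eq_1_if_short_flow)
  \<comment> \<open>The reflection reverses the sign, so \<open>g\<close> would also have
    determinant -1.\<close>
  moreover have "det (matrix g) = det (matrix f) * det (matrix (reflect e))"
    unfolding g_def using lin by (simp add: matrix_compose det_mul)
  moreover have "e \<noteq> 0" using e(1) by auto
  ultimately show False using det by (simp add: det_reflect)
qed

section \<open>Rotations carrying one system of vectors to another\<close>

text \<open>Each new vector is corrected by a reflection taking \<open>f (u k)\<close> to
  \<open>v k\<close>. Equality of the Gram matrices makes the earlier \<open>v j\<close> orthogonal
  to \<open>f (u k) - v k\<close>, so the reflection fixes them.\<close>

lemma equal_gram_orthogonal_transformation:
  fixes u v :: "'p \<Rightarrow> 'a::euclidean_space"
  assumes "finite J" "\<And>i j. i \<in> J \<Longrightarrow> j \<in> J \<Longrightarrow> u i \<bullet> u j = v i \<bullet> v j"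
  shows "\<exists>f. orthogonal_transformation f \<and> (\<forall>j\<in>J. f (u j) = v j)"
  using assms
proof (induction J rule: finite_induct)
  case empty
  then show ?case using orthogonal_transformation_id by blast
next
  case (insert k J)
  then obtain f where f: "orthogonal_transformation f" "\<And>j. j \<in> J \<Longrightarrow> f (u j) = v j"
    by blast
  have iso: "f x \<bullet> f y = x \<bullet> y" for x y using f by (simp add: orthogonal_transformation_def)
  define g where "g = reflect (f (u k) - v k) \<circ> f"
  have "norm (f (u k)) = norm (v k)"
    using insert.prems[of k k] by (simp add: norm_eq iso)
  then have "g (u k) = v k" by (simp add: g_def reflect_swap)
  moreover have "g (u j) = v j" if "j \<in> J" for j
  proof -
    have "v j \<bullet> f (u k) = v j \<bullet> v k"
      using insert.prems[of j k] that f(2)[OF that] iso by (metis insertCI)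
    then show ?thesis by (simp add: g_def f(2)[OF that] reflect_perp inner_diff_right)
  qed
  moreover have "orthogonal_transformation g"
    unfolding g_def by (intro orthogonal_transformation_compose orthogonal_transformation_reflect f)
  ultimately show ?case by blast
qed

text \<open>Fewer vectors than dimensions leave a direction \<open>z\<close> orthogonal to all
  \<open>v j\<close>; reflecting along \<open>z\<close> flips the determinant without moving
  them.\<close>

lemma equal_gram_rotation:
  fixes u v :: "'p::finite \<Rightarrow> real^'n"
  assumes uv: "\<And>i j. u i \<bullet> u j = v i \<bullet> v j" and card: "CARD('p) < CARD('n)"
  obtains f where "orthogonal_transformation f" "det (matrix f) = 1" "\<And>j. f (u j) = v j"
proof -
  obtain f where f: "orthogonal_transformation f" "\<And>j. f (u j) = v j"
    using equal_gram_orthogonal_transformation[of UNIV u v] uv by auto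
  have "dim (range v) \<le> CARD('p)"
    using card_image_le[of UNIV v] dim_le_card'[of "range v"] by simp
  then have "dim (range v) < DIM(real^'n)" using card by simp
  then obtain z where z: "z \<noteq> 0" "\<And>y. y \<in> span (range v) \<Longrightarrow> orthogonal z y"
    by (rule orthogonal_to_subspace_exists) blast
  define g where "g = reflect z \<circ> f"
  have g: "orthogonal_transformation g"
    unfolding g_def by (intro orthogonal_transformation_compose orthogonal_transformation_reflect f)
  have gv: "g (u j) = v j" for j
    using z(2)[of "v j"] by (simp add: span_base g_def f reflect_perp orthogonal_def inner_commute)
  have "det (matrix g) = - det (matrix f)"
    unfolding g_def using z(1) orthogonal_transformation_linear[OF f(1)]
      orthogonal_transformation_linear[OF orthogonal_transformation_reflect[of z]]
    by (simp add: matrix_compose det_mul det_reflect)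
  moreover have "\<bar>det (matrix f)\<bar> = 1" using f by simp
  ultimately consider "det (matrix f) = 1" | "det (matrix g) = 1" by linarith
  then show thesis
  proof cases
    case 1
    show thesis by (rule that[OF f(1) 1 f(2)])
  next
    case 2
    show thesis by (rule that[OF g 2 gv])
  qed
qed

subsection \<open>Curves on the Stiefel manifold\<close>

lemma stiefel_iff_column_inner:
  fixes U :: "real^'p^'n"
  shows "U \<in> stiefel \<longleftrightarrow> (\<forall>i j. column i U \<bullet> column j U = (if i = j then 1 else 0))"
  by (simp add: stiefel_def matrix_mult_transpose_dot_column vec_eq_iff mat_def)

lemma norm_sq_columns:
  fixes M :: "real^'p^'n"
  shows "(norm M)\<^sup>2 = (\<Sum>j\<in>UNIV. (norm (column j M))\<^sup>2)"
  unfolding norm_eq_frobenius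
  by (subst sum.swap) (simp add: norm_vec_def L2_set_def sum_nonneg column_def)

lemma norm_stiefel:
  fixes U :: "real^'p^'n"
  assumes "U \<in> stiefel"
  shows "norm U = sqrt (real CARD('p))"
proof -
  have "(norm U)\<^sup>2 = real CARD('p)"
    using assms by (simp add: norm_sq_columns stiefel_iff_column_inner power2_norm_eq_inner)
  then show ?thesis by (metis norm_ge_zero real_sqrt_unique)
qed

lemma exists_short_stiefel_curve:
  fixes U V :: "real^'p^'n"
  assumes UV: "U \<in> stiefel" "V \<in> stiefel" and card: "CARD('p) < CARD('n)"
  obtains \<gamma> where "stiefel_curve U V \<gamma>" "curve_length \<gamma> \<le> pi * sqrt (real CARD('p))"
    "curve_length \<gamma> = pi * sqrt (real CARD('p)) \<longrightarrow> V = - U"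
proof -
  obtain f where f: "orthogonal_transformation f" "det (matrix f) = 1" "\<And>j. f (column j U) = column j V"
    using equal_gram_rotation[of "\<lambda>j. column j U" "\<lambda>j. column j V"] UV card
    by (auto simp: stiefel_iff_column_inner)
  obtain E A where lin: "linear A" "\<And>t. linear (E t)" and A: "\<And>x. norm (A x) \<le> pi * norm x"
     "\<And>x. norm (A x) = pi * norm x \<Longrightarrow> f x = - x"
     and E: "\<And>x. E 0 x = x" "\<And>x. E 1 x = f x"
     "\<And>t x. norm (E t x) = norm x" "\<And>t x. ((\<lambda>t. E t x) has_vector_derivative E t (A x)) (at t)"
    using rotation_short_flow[OF f(1,2)] unfolding short_flow_def by simp metis
  have Eorth: "orthogonal_transformation (E t)" for t
    using E lin by (simp add: orthogonal_transformation)
  \<comment> \<open>\<open>E t\<close> applied column by column, that is, left multiplication by its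
    matrix. \<open>AU\<close> below is the initial velocity of the curve.\<close>
  define \<Phi> where "\<Phi> = (\<lambda>t (M :: real^'p^'n). (\<chi> i j. E t (column j M) $ i) :: real^'p^'n)"
  define AU :: "real^'p^'n" where "AU = (\<chi> i j. A (column j U) $ i)"
  have col\<Phi>: "column j (\<Phi> t M) = E t (column j M)" for j t M
    by (simp add: \<Phi>_def column_def vec_eq_iff)
  have colAU: "column j AU = A (column j U)" for j
    by (simp add: AU_def column_def vec_eq_iff)
  have eqI: "M = N" if "\<And>j. column j M = column j N" for M N :: "real^'p^'n"
    using that by (simp add: column_def vec_eq_iff)
  have der: "((\<lambda>t. \<Phi> t U) has_vector_derivative \<Phi> t AU) (at t)" for t
  proof -
    \<comment> \<open>\<open>L j\<close> inserts a vector as column \<open>j\<close>. Summing these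
      linear maps transfers the derivative from columns to matrices.\<close>
    define L where "L = (\<lambda>j x. (\<chi> i k. if k = j then x $ i else 0) :: real^'p^'n)"
    have "linear (L j)" for j
      by (auto simp: L_def linear_iff vec_eq_iff)
    then have "bounded_linear (L j)" for j
      by (simp add: linear_conv_bounded_linear)
    then have "((\<lambda>t. L j (E t (column j U))) has_vector_derivative L j (E t (A (column j U)))) (at t)" for j
      using E(4) by (rule bounded_linear.has_vector_derivative)
    then have "((\<lambda>t. \<Sum>j\<in>UNIV. L j (E t (column j U))) has_vector_derivative
        (\<Sum>j\<in>UNIV. L j (E t (A (column j U))))) (at t)"
      by (rule has_vector_derivative_sum)
    moreover have "\<Phi> t M = (\<Sum>j\<in>UNIV. L j (E t (column j M)))" for t M
      by (simp add: \<Phi>_def L_def vec_eq_iff)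
    ultimately show ?thesis by (simp add: colAU)
  qed
  have cont: "continuous_on {0..1} (\<lambda>t. \<Phi> t AU)"
  proof -
    have "continuous_on {0..1} (\<lambda>t. E t x)" for x
      using E(4) by (meson continuous_at_imp_continuous_on has_vector_derivative_continuous)
    then show ?thesis unfolding \<Phi>_def by (intro continuous_intros) auto
  qed
  have stief: "\<Phi> t U \<in> stiefel" for t
    using UV(1) Eorth[of t] by (simp add: stiefel_iff_column_inner col\<Phi> orthogonal_transformation_def)
  have curve: "stiefel_curve U V (\<lambda>t. \<Phi> t U)"
    unfolding stiefel_curve_def
  proof (intro conjI exI[of _ "\<lambda>t. \<Phi> t AU"] ballI)
    show "\<Phi> 0 U = U" "\<Phi> 1 U = V" by (rule eqI, simp add: col\<Phi> E f)+
    show "(\<lambda>t. \<Phi> t U) ` {0..1} \<subseteq> stiefel" using stief by blast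
  qed (use cont der in \<open>simp_all add: has_vector_derivative_at_within\<close>)
  \<comment> \<open>The speed is constant because \<open>E t\<close> is isometric on each column;
    hence the length is \<open>norm AU\<close>.\<close>
  have n\<Phi>: "norm (\<Phi> t AU) = norm AU" for t
  proof -
    have "(norm (\<Phi> t AU))\<^sup>2 = (norm AU)\<^sup>2" by (simp add: norm_sq_columns col\<Phi> E)
    then show ?thesis by simp
  qed
  have "vector_derivative (\<lambda>t. \<Phi> t U) (at t within {0..1}) = \<Phi> t AU" if "t \<in> {0..1}" for t
    using der that by (intro vector_derivative_at_within_ivl) auto
  then have len: "curve_length (\<lambda>t. \<Phi> t U) = norm AU"
    unfolding curve_length_def
    by (subst integral_cong[where g = "\<lambda>_. norm AU"]) (auto simp: n\<Phi>)
  have colU: "norm (column j U) = 1" for j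
    using UV(1) by (simp add: stiefel_iff_column_inner norm_eq_1)
  have le1: "(norm (A (column j U)))\<^sup>2 \<le> pi\<^sup>2" for j
    using A(1)[of "column j U"] by (intro power_mono) (auto simp: colU)
  have nAU: "(norm AU)\<^sup>2 = (\<Sum>j\<in>UNIV. (norm (A (column j U)))\<^sup>2)"
    by (simp add: norm_sq_columns colAU)
  also have "\<dots> \<le> (\<Sum>j\<in>(UNIV::'p set). pi\<^sup>2)" by (intro sum_mono le1)
  also have "\<dots> = (pi * sqrt (real CARD('p)))\<^sup>2" by (simp add: power_mult_distrib)
  finally have le: "norm AU \<le> pi * sqrt (real CARD('p))"
    by (rule power2_le_imp_le) simp
  have "V = - U" if eq: "norm AU = pi * sqrt (real CARD('p))"
  proof -
    \<comment> \<open>Every summand is at most \<open>pi\<^sup>2\<close>, so equality of the sums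
      forces equality in each column, and \<open>f\<close> negates each column of
      \<open>U\<close>.\<close>
    have "(\<Sum>j\<in>UNIV. (norm (A (column j U)))\<^sup>2) = (\<Sum>j\<in>(UNIV::'p set). pi\<^sup>2)"
      unfolding nAU[symmetric] eq by (simp add: power_mult_distrib)
    then have "(norm (A (column j U)))\<^sup>2 = pi\<^sup>2" for j
      by (intro sum_mono_inv[OF _ le1]) auto
    then have "norm (A (column j U)) = pi * norm (column j U)" for j
      by (simp add: colU power2_eq_iff_nonneg)
    then have "f (column j U) = - column j U" for j by (rule A(2))
    then have "column j V = column j (- U)" for j
      using f(3) by (simp add: column_def vec_eq_iff)
    then show ?thesis by (rule eqI)
  qed
  then show thesis using that[OF curve] le by (simp add: len)
qed

section \<open>Length of curves joining antipodal points of a sphere\<close>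

text \<open>A tangent vector at \<open>x\<close> sees only the component of \<open>u\<close>
  orthogonal to \<open>x\<close>, whose length is \<open>r\<close> times the sine of the angle
  between \<open>x\<close> and \<open>u\<close>. Cauchy-Schwarz then bounds how fast the cosine of
  this angle can change.\<close>

lemma sphere_speed_bound:
  fixes x v u :: "'a::real_inner"
  assumes "x \<bullet> x = r\<^sup>2" "u \<bullet> u = r\<^sup>2" "r > 0" "v \<bullet> x = 0"
  shows "\<bar>v \<bullet> u\<bar> / r\<^sup>2 \<le> norm v / r * sqrt (1 - ((x \<bullet> u) / r\<^sup>2)\<^sup>2)"
proof -
  define h where "h = (x \<bullet> u) / r\<^sup>2"
  have xu: "x \<bullet> u = h * r\<^sup>2" using assms by (simp add: h_def)
  have "v \<bullet> u = v \<bullet> (u - h *\<^sub>R x)" using assms by (simp add: inner_diff_right)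
  then have "\<bar>v \<bullet> u\<bar> \<le> norm v * norm (u - h *\<^sub>R x)"
    using Cauchy_Schwarz_ineq2 by metis
  also have "norm (u - h *\<^sub>R x) = r * sqrt (1 - h\<^sup>2)"
  proof -
    have "(u - h *\<^sub>R x) \<bullet> (u - h *\<^sub>R x) = r\<^sup>2 * (1 - h\<^sup>2)"
      using assms xu by (simp add: inner_diff_left inner_diff_right inner_commute power2_eq_square algebra_simps)
    then show ?thesis using assms by (simp add: norm_eq_sqrt_inner real_sqrt_mult)
  qed
  finally show ?thesis using assms
    unfolding h_def[symmetric] by (simp add: field_simps power2_eq_square)
qed

text \<open>The angle between \<open>\<gamma> t\<close> and \<open>\<gamma> 0\<close> has cosine
  \<open>h t\<close>, grows at most at rate speed over \<open>r\<close>, and must go from 0 to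
  pi.\<close>

lemma curve_length_antipodal:
  fixes \<gamma> :: "real \<Rightarrow> 'a::euclidean_space"
  assumes r: "r > 0" and sph: "\<And>t. t \<in> {0..1} \<Longrightarrow> norm (\<gamma> t) = r" and ends: "\<gamma> 1 = - \<gamma> 0"
    and der: "\<And>t. t \<in> {0..1} \<Longrightarrow> (\<gamma> has_vector_derivative \<gamma>' t) (at t within {0..1})"
    and cont: "continuous_on {0..1} \<gamma>'"
  shows "pi * r \<le> integral {0..1} (\<lambda>t. norm (\<gamma>' t))"
proof -
  define u where "u = \<gamma> 0"
  define L where "L = integral {0..1} (\<lambda>t. norm (\<gamma>' t))"
  define h where "h = (\<lambda>t. (\<gamma> t \<bullet> u) / r\<^sup>2)"
  have gg: "\<gamma> t \<bullet> \<gamma> t = r\<^sup>2" if "t \<in> {0..1}" for t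
    using sph[OF that] by (simp add: power2_norm_eq_inner[symmetric])
  have uu: "u \<bullet> u = r\<^sup>2" using gg[of 0] by (simp add: u_def)
  \<comment> \<open>Velocity is tangent to the sphere: the constant
    \<open>\<gamma> t \<bullet> \<gamma> t\<close> is differentiated in two ways.\<close>
  have perp: "\<gamma>' t \<bullet> \<gamma> t = 0" if t: "t \<in> {0..1}" for t
  proof -
    have 1: "((\<lambda>t. \<gamma> t \<bullet> \<gamma> t) has_vector_derivative \<gamma> t \<bullet> \<gamma>' t + \<gamma>' t \<bullet> \<gamma> t) (at t within {0..1})"
      using bounded_bilinear.has_vector_derivative[OF bounded_bilinear_inner der[OF t] der[OF t]] .
    have "((\<lambda>t. r\<^sup>2) has_vector_derivative 0) (at t within {0..1})" by (rule has_vector_derivative_const)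
    then have 2: "((\<lambda>t. \<gamma> t \<bullet> \<gamma> t) has_vector_derivative 0) (at t within {0..1})"
      by (rule has_vector_derivative_transform[OF t, rotated]) (rule gg)
    have "\<gamma> t \<bullet> \<gamma>' t + \<gamma>' t \<bullet> \<gamma> t = 0"
      using t by (intro vector_derivative_unique_within[OF _ 1 2]) (simp add: trivial_limit_within islimpt_Icc)
    then show ?thesis by (simp add: inner_commute)
  qed
  have hb: "\<bar>h t\<bar> \<le> 1" if "t \<in> {0..1}" for t
  proof -
    have "\<bar>\<gamma> t \<bullet> u\<bar> \<le> norm (\<gamma> t) * norm u" by (rule Cauchy_Schwarz_ineq2)
    also have "\<dots> = r\<^sup>2" using sph[OF that] sph[of 0] by (simp add: u_def power2_eq_square)
    finally show ?thesis using r by (simp add: h_def)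
  qed
  \<comment> \<open>The factor \<open>k < 1\<close> keeps \<open>k * h\<close> away from \<open>\<plusminus>1\<close>, where \<open>arccos\<close> is not differentiable.\<close>
  have key: "arccos (- k) - arccos k \<le> L / r" if k: "0 < k" "k < 1" for k
  proof -
    define \<phi>' where "\<phi>' = (\<lambda>t. - (k * ((\<gamma>' t \<bullet> u) / r\<^sup>2)) / sqrt (1 - (k * h t)\<^sup>2))"
    have kh: "\<bar>k * h t\<bar> < 1" if "t \<in> {0..1}" for t
    proof -
      have "k * \<bar>h t\<bar> \<le> k * 1" using hb[OF that] k by (intro mult_left_mono) auto
      also have "\<dots> < 1" using k by simp
      finally show ?thesis using k by (simp add: abs_mult)
    qed
    have d\<phi>: "((\<lambda>t. arccos (k * h t)) has_vector_derivative \<phi>' t) (at t within {0..1})" if t: "t \<in> {0..1}" for t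
    proof -
      have "(h has_real_derivative (\<gamma>' t \<bullet> u) / r\<^sup>2) (at t within {0..1})"
        unfolding h_def has_real_derivative_iff_has_vector_derivative
        using bounded_linear.has_vector_derivative[OF bounded_linear_inner_left der[OF t], of u]
        by (simp add: has_vector_derivative_divide)
      then have "((\<lambda>t. k * h t) has_real_derivative k * ((\<gamma>' t \<bullet> u) / r\<^sup>2)) (at t within {0..1})"
        by (rule DERIV_cmult)
      moreover have "(arccos has_real_derivative inverse (- sqrt (1 - (k * h t)\<^sup>2))) (at (k * h t))"
        using kh[OF t] by (intro DERIV_arccos) auto
      ultimately have "((\<lambda>t. arccos (k * h t)) has_real_derivative
          inverse (- sqrt (1 - (k * h t)\<^sup>2)) * (k * ((\<gamma>' t \<bullet> u) / r\<^sup>2))) (at t within {0..1})"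
        by (rule DERIV_chain2[rotated])
      then show ?thesis
        unfolding has_real_derivative_iff_has_vector_derivative[symmetric] \<phi>'_def
        by (simp add: divide_inverse mult.commute)
    qed
    \<comment> \<open>As \<open>h\<close> runs from 1 to -1, \<open>arccos (k * h t)\<close> runs
      from \<open>arccos k\<close> to \<open>arccos (- k)\<close>.\<close>
    have "(\<phi>' has_integral (arccos (k * h 1) - arccos (k * h 0))) {0..1}"
      by (intro fundamental_theorem_of_calculus d\<phi>) auto
    moreover have "h 0 = 1" "h 1 = - 1" using uu r ends by (simp_all add: h_def u_def)
    ultimately have int: "(\<phi>' has_integral (arccos (- k) - arccos k)) {0..1}" by simp
    have "((\<lambda>t. norm (\<gamma>' t)) has_integral L) {0..1}"
      unfolding L_def using cont
      by (intro integrable_integral integrable_continuous_real continuous_on_norm)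
    then have int2: "((\<lambda>t. norm (\<gamma>' t) / r) has_integral L / r) {0..1}"
      by (rule has_integral_divide)
    have "\<phi>' t \<le> norm (\<gamma>' t) / r" if t: "t \<in> {0..1}" for t
    proof -
      have pos: "0 < 1 - (k * h t)\<^sup>2" using kh[OF t] by (simp add: abs_square_less_1)
      have kk: "k\<^sup>2 \<le> 1" using k by (simp add: power_le_one)
      have "k * (- (\<gamma>' t \<bullet> u) / r\<^sup>2) \<le> k * (\<bar>\<gamma>' t \<bullet> u\<bar> / r\<^sup>2)"
        using k by (intro mult_left_mono divide_right_mono) auto
      then have "\<phi>' t \<le> k * (\<bar>\<gamma>' t \<bullet> u\<bar> / r\<^sup>2) / sqrt (1 - (k * h t)\<^sup>2)"
        unfolding \<phi>'_def using pos by (intro divide_right_mono) auto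
      also have "\<dots> \<le> k * (norm (\<gamma>' t) / r * sqrt (1 - (h t)\<^sup>2)) / sqrt (1 - (k * h t)\<^sup>2)"
        using sphere_speed_bound[OF gg[OF t] uu r perp[OF t]] k pos
        by (intro divide_right_mono mult_left_mono) (auto simp: h_def)
      \<comment> \<open>With \<open>k\<close> moved under the root the quotient is at most 1,
        because \<open>k\<^sup>2 - k\<^sup>2 * (h t)\<^sup>2\<close> is at most
        \<open>1 - (k * h t)\<^sup>2\<close>.\<close>
      also have "\<dots> = norm (\<gamma>' t) / r * (sqrt (k\<^sup>2 * (1 - (h t)\<^sup>2)) / sqrt (1 - (k * h t)\<^sup>2))"
        using k by (simp add: real_sqrt_mult)
      also have "\<dots> \<le> norm (\<gamma>' t) / r * 1"
        using pos r kk by (intro mult_left_mono) (auto simp: power_mult_distrib algebra_simps)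
      finally show ?thesis by simp
    qed
    then show ?thesis by (intro has_integral_le[OF int int2])
  qed
  \<comment> \<open>Let \<open>k\<close> tend to 1 from below: \<open>arccos\<close> is continuous
    up to the endpoints, so the left side of \<open>key\<close> tends to pi.\<close>
  have "((\<lambda>k. arccos (- k) - arccos k) \<longlongrightarrow> arccos (- 1) - arccos 1) (at 1 within {-1..1})"
  proof -
    have "continuous_on {-1..1} (\<lambda>k::real. arccos (- k) - arccos k)"
      by (intro continuous_intros) auto
    then show ?thesis
      unfolding continuous_on_def by (rule bspec) simp
  qed
  then have "((\<lambda>k. arccos (- k) - arccos k) \<longlongrightarrow> pi) (at 1 within {0<..<1})"
    unfolding arccos_minus_1 arccos_1 diff_0_right by (rule tendsto_within_subset) auto
  moreover have "\<forall>\<^sub>F k in at 1 within {0<..<1::real}. arccos (- k) - arccos k \<le> L / r"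
    using key by (auto simp: eventually_at_filter)
  moreover have "at (1::real) within {0<..<1} \<noteq> bot"
    by (simp add: trivial_limit_within islimpt_greaterThanLessThan2)
  ultimately have "pi \<le> L / r" by (intro tendsto_upperbound)
  then show ?thesis using r by (simp add: L_def field_simps)
qed

section \<open>Distance bounds and the diameter\<close>

lemma euclidean_geodesic_dist_antipodal_ge:
  fixes U :: "real^'p^'n"
  shows "ereal (pi * sqrt (real CARD('p))) \<le> euclidean_geodesic_dist U (- U)"
  unfolding euclidean_geodesic_dist_def
proof (rule INF_greatest, clarsimp)
  fix \<gamma> assume "stiefel_curve U (- U) \<gamma>"
  then obtain \<gamma>' where \<gamma>: "\<And>t. t \<in> {0..1} \<Longrightarrow> \<gamma> t \<in> stiefel" "\<gamma> 0 = U" "\<gamma> 1 = - U"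
    "\<And>t. t \<in> {0..1} \<Longrightarrow> (\<gamma> has_vector_derivative \<gamma>' t) (at t within {0..1})"
    "continuous_on {0..1} \<gamma>'"
    unfolding stiefel_curve_def by blast
  have "pi * sqrt (real CARD('p)) \<le> integral {0..1} (\<lambda>t. norm (\<gamma>' t))"
    using \<gamma> by (intro curve_length_antipodal) (auto simp: norm_stiefel)
  \<comment> \<open>Derivatives within a nondegenerate interval are unique, so
    \<open>\<gamma>'\<close> agrees with the \<open>vector_derivative\<close> in the definition of
    length.\<close>
  also have "\<dots> = curve_length \<gamma>"
    unfolding curve_length_def using \<gamma>(4)
    by (intro integral_cong) (metis vector_derivative_within_closed_interval zero_less_one)
  finally show "pi * sqrt (real CARD('p)) \<le> curve_length \<gamma>" .
qed

text \<open>The infimum is at most the length of the short curve; when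
  \<open>V \<noteq> - U\<close>, that one curve is already strictly shorter than the bound.\<close>

lemma euclidean_geodesic_dist_le:
  fixes U V :: "real^'p^'n"
  assumes UV: "U \<in> stiefel" "V \<in> stiefel" and card: "CARD('p) < CARD('n)"
  shows "euclidean_geodesic_dist U V \<le> ereal (pi * sqrt (real CARD('p)))"
    and "V \<noteq> - U \<Longrightarrow> euclidean_geodesic_dist U V < ereal (pi * sqrt (real CARD('p)))"
proof -
  obtain \<gamma> where \<gamma>: "stiefel_curve U V \<gamma>" "curve_length \<gamma> \<le> pi * sqrt (real CARD('p))"
    "curve_length \<gamma> = pi * sqrt (real CARD('p)) \<longrightarrow> V = - U"
    using exists_short_stiefel_curve[OF assms] by blast
  have le: "euclidean_geodesic_dist U V \<le> ereal (curve_length \<gamma>)"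
    unfolding euclidean_geodesic_dist_def using \<gamma>(1) by (intro INF_lower) auto
  also have "\<dots> \<le> ereal (pi * sqrt (real CARD('p)))" using \<gamma>(2) by simp
  finally show "euclidean_geodesic_dist U V \<le> ereal (pi * sqrt (real CARD('p)))" .
  assume "V \<noteq> - U"
  then have "ereal (curve_length \<gamma>) < ereal (pi * sqrt (real CARD('p)))" using \<gamma>(2,3) by auto
  with le show "euclidean_geodesic_dist U V < ereal (pi * sqrt (real CARD('p)))" by (rule le_less_trans)
qed

lemma stiefel_nonempty:
  assumes "CARD('p::finite) \<le> CARD('n::finite)"
  shows "(stiefel :: (real^'p^'n) set) \<noteq> {}"
proof -
  obtain g :: "'p \<Rightarrow> 'n" where "inj g"
    using card_le_inj[of "UNIV :: 'p set" "UNIV :: 'n set"] assms by auto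
  \<comment> \<open>The columns are distinct standard basis vectors, selected by the injection
    \<open>g\<close>.\<close>
  define W :: "real^'p^'n" where "W = (\<chi> i j. if i = g j then 1 else 0)"
  have "column j W = axis (g j) 1" for j
    by (simp add: W_def column_def axis_def vec_eq_iff)
  then have "W \<in> stiefel"
    using \<open>inj g\<close> by (simp add: stiefel_iff_column_inner inner_axis_axis inj_eq)
  then show ?thesis by blast
qed

lemma stiefel_uminus: "U \<in> stiefel \<Longrightarrow> - U \<in> stiefel"
  by (simp add: stiefel_iff_column_inner column_def inner_vec_def)

theorem theorem6p6:
  assumes "CARD('n::finite) \<ge> 2 * CARD('p::finite)"
  shows "(SUP (U, V)\<in>(stiefel :: (real^'p^'n) set) \<times> stiefel. euclidean_geodesic_dist U V)
           = ereal (pi * sqrt (real CARD('p))) \<and>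
         (\<forall>U\<in>(stiefel :: (real^'p^'n) set). \<forall>V\<in>stiefel.
           euclidean_geodesic_dist U V = ereal (pi * sqrt (real CARD('p))) \<longleftrightarrow> V = - U)"
proof (intro conjI ballI)
  have "0 < CARD('p)" by simp
  \<comment> \<open>Strict since \<open>p\<close> is at least 1; this provides the spare direction
    for correcting the determinant.\<close>
  then have card: "CARD('p) < CARD('n)" using assms by linarith
  have antipodal: "euclidean_geodesic_dist U (- U) = ereal (pi * sqrt (real CARD('p)))"
    if "U \<in> stiefel" for U :: "real^'p^'n"
    using euclidean_geodesic_dist_le(1)[OF that stiefel_uminus[OF that] card]
      euclidean_geodesic_dist_antipodal_ge[of U] by (rule antisym)
  obtain W :: "real^'p^'n" where W: "W \<in> stiefel"
    using stiefel_nonempty[where 'p = 'p and 'n = 'n] card by auto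
  show "(SUP (U, V)\<in>(stiefel :: (real^'p^'n) set) \<times> stiefel. euclidean_geodesic_dist U V)
      = ereal (pi * sqrt (real CARD('p)))"
  proof (rule antisym)
    show "(SUP (U, V)\<in>(stiefel :: (real^'p^'n) set) \<times> stiefel. euclidean_geodesic_dist U V)
      \<le> ereal (pi * sqrt (real CARD('p)))"
      using euclidean_geodesic_dist_le(1)[OF _ _ card] by (intro SUP_least) auto
    show "ereal (pi * sqrt (real CARD('p)))
      \<le> (SUP (U, V)\<in>(stiefel :: (real^'p^'n) set) \<times> stiefel. euclidean_geodesic_dist U V)"
      using W stiefel_uminus[OF W] antipodal[OF W]
      by (intro SUP_upper2[of "(W, - W)"]) auto
  qed
  fix U V :: "real^'p^'n"
  assume U: "U \<in> stiefel" and V: "V \<in> stiefel"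
  show "euclidean_geodesic_dist U V = ereal (pi * sqrt (real CARD('p))) \<longleftrightarrow> V = - U"
    using euclidean_geodesic_dist_le(2)[OF U V card] antipodal[OF U] by (metis less_irrefl)
qed

end
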